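(* Let $k\geq 2$. There is no $k$-geodetic digraph with minimum out-degree at least $2$ and order $M(2,k)+2$ (where $M(2,k)=1+2+\dots+2^k$) whose in-degree sequence is $(1,1,1,1,2,\dots,2,4,4)$, i.e. exactly four vertices have in-degree $1$, exactly two have in-degree $4$, and all others have in-degree $2$.
   Context: A digraph is $k$-geodetic if for any two vertices $u,v$ there is at most one directed walk from $u$ to $v$ of length at most $k$. The in-degree sequence is the list of in-degrees of the vertices in non-decreasing order. *)

theory Defs
  imports "Graph_Theory.Graph_Theory" "HOL-Library.Multiset"
begin

(* Walks of length 0 count, so for u = v the condition says that there is no closed walk
   of length 1, ..., k. Walks are lists of arcs, so parallel arcs are distinct walks. *)
definition k_geodetic :: "nat \<Rightarrow> ('a, 'b) pre_digraph \<Rightarrow> bool" where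
  "k_geodetic k G \<longleftrightarrow>
     (\<forall>u \<in> verts G. \<forall>v \<in> verts G. \<forall>p q.
        pre_digraph.awalk G u p v \<and> length p \<le> k \<and>
        pre_digraph.awalk G u q v \<and> length q \<le> k \<longrightarrow> p = q)"

definition min_out_degree :: "('a, 'b) pre_digraph \<Rightarrow> nat" where
  "min_out_degree G = Min (out_degree G ` verts G)"

definition in_degree_sequence :: "('a, 'b) pre_digraph \<Rightarrow> nat list" where
  "in_degree_sequence G =
     sorted_list_of_multiset (image_mset (in_degree G) (mset_set (verts G)))"

definition moore_bound :: "nat \<Rightarrow> nat \<Rightarrow> nat" where
  "moore_bound d k = (\<Sum>i\<le>k. d ^ i)"

(* For k \<ge> 1 it makes no difference whether loops and parallel arcs are admitted. *)
lemma k_geodetic_imp_digraph: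
  assumes "fin_digraph G" and geo: "k_geodetic k G" and "k \<ge> 1"
  shows "digraph G"
proof -
  interpret fin_digraph G by fact
  have arc_walk: "awalk (tail G e) [e] (head G e)" if "e \<in> arcs G" for e
    using that by (simp add: awalk_def)
  show ?thesis
  proof unfold_locales
    fix e assume e: "e \<in> arcs G"
    have "awalk (tail G e) [] (tail G e)"
      using e by (simp add: awalk_def)
    then show "tail G e \<noteq> head G e"
      using geo e arc_walk[OF e] \<open>k \<ge> 1\<close> unfolding k_geodetic_def
      by (metis One_nat_def length_Cons list.distinct(1) list.size(3) tail_in_verts zero_le)
  next
    fix e f assume e: "e \<in> arcs G" and f: "f \<in> arcs G"
      and "arc_to_ends G e = arc_to_ends G f"
    then have "tail G f = tail G e" "head G f = head G e"
      by (simp_all add: arc_to_ends_def)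
    then have "awalk (tail G e) [f] (head G e)"
      using arc_walk[OF f] by simp
    moreover have "tail G e \<in> verts G" "head G e \<in> verts G"
      using e by simp_all
    ultimately have "[e] = [f]"
      using geo arc_walk[OF e] \<open>k \<ge> 1\<close> unfolding k_geodetic_def
      by (metis One_nat_def length_Cons list.size(3))
    then show "e = f" by simp
  qed
qed

end

theory Submission
  imports Defs
begin

text \<open>
  Counting arcs, every out-degree is exactly 2, so every vertex u reaches all but a set O(u) of at
  most two vertices by walks of length at most k. If v has in-degree 4, then at most two of its
  in-neighbours are reached from u, because walks from u to v of length at most k + 1 are
  determined by their first arc; hence O(u) is contained in the in-neighbourhood of v. On the other
  hand each of the four vertices of in-degree 1 lies in some O(u). So these four vertices all have
  the two vertices of in-degree 4 as their out-neighbours. A walk of length at most k from one of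
  the four to another would then contain all but the first arc of a closed walk of length at
  most k, so each of the four vertices has the three others as outliers, a contradiction.
\<close>

section \<open>Out-balls and the Moore bound\<close>

text \<open>Closed ball for directed distance. The overview's O(u) is
  \<open>verts G - out_ball G k u\<close>.\<close>

definition out_ball :: "('a, 'b) pre_digraph \<Rightarrow> nat \<Rightarrow> 'a \<Rightarrow> 'a set" where
  "out_ball G j u = {x. \<exists>p. pre_digraph.awalk G u p x \<and> length p \<le> j}"

lemma moore_bound_Suc: "moore_bound 2 (Suc j) = 1 + 2 * moore_bound 2 j"
  unfolding moore_bound_def by (simp add: sum.atMost_Suc_shift sum_distrib_left del: sum.atMost_Suc)

text \<open>Guarantees that the natural-number subtraction \<open>moore_bound 2 k - 4\<close> in the
  in-degree sequence does not truncate.\<close>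

lemma moore_bound_ge_4: "k \<ge> 2 \<Longrightarrow> moore_bound 2 k \<ge> 4"
proof -
  assume "k \<ge> 2"
  then have "sum ((^) 2) {..2} \<le> (sum ((^) 2) {..k} :: nat)"
    by (intro sum_mono2) auto
  then show ?thesis
    unfolding moore_bound_def by (simp add: numeral_2_eq_2)
qed

context fin_digraph
begin

lemma awalk_unique:
  assumes "k_geodetic k G" "awalk u p v" "awalk u q v" "length p \<le> k" "length q \<le> k"
  shows "p = q"
  using assms unfolding k_geodetic_def by (meson awalk_hd_in_verts awalk_last_in_verts)

lemma awalk_snoc:
  assumes "awalk u p (tail G e)" "e \<in> arcs G"
  shows "awalk u (p @ [e]) (head G e)"
  using assms by (simp add: awalk_append_iff awalk_Cons_iff awalk_Nil_iff)

lemma sum_in_degree: "(\<Sum>v\<in>verts G. in_degree G v) = card (arcs G)"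
proof -
  have "card (\<Union>v\<in>verts G. in_arcs G v) = (\<Sum>v\<in>verts G. card (in_arcs G v))"
    by (rule card_UN_disjoint) (auto simp: in_arcs_def)
  moreover have "(\<Union>v\<in>verts G. in_arcs G v) = arcs G"
    by auto
  ultimately show ?thesis by (simp add: in_degree_def)
qed

lemma sum_out_degree: "(\<Sum>v\<in>verts G. out_degree G v) = card (arcs G)"
proof -
  have "card (\<Union>v\<in>verts G. out_arcs G v) = (\<Sum>v\<in>verts G. card (out_arcs G v))"
    by (rule card_UN_disjoint) (auto simp: out_arcs_def)
  moreover have "(\<Union>v\<in>verts G. out_arcs G v) = arcs G"
    by auto
  ultimately show ?thesis by (simp add: out_degree_def)
qed

lemma out_ball_subset: "out_ball G j u \<subseteq> verts G"
  by (auto simp: out_ball_def)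

lemma finite_out_ball: "finite (out_ball G j u)"
  using out_ball_subset finite_verts by (rule finite_subset)

text \<open>Induction on the radius. The balls of radius \<open>j\<close> around the heads of two
  out-arcs of \<open>u\<close> are disjoint and avoid \<open>u\<close>: otherwise \<open>u\<close>
  would start two distinct walks of length at most \<open>k\<close> with the same end, one of them
  empty in the second case. This matches the recursion of the Moore bound.\<close>

lemma card_out_ball_ge:
  assumes "k_geodetic k G" and deg: "\<And>v. v \<in> verts G \<Longrightarrow> out_degree G v \<ge> 2"
    and "j \<le> k" "u \<in> verts G"
  shows "card (out_ball G j u) \<ge> moore_bound 2 j"
  using \<open>j \<le> k\<close> \<open>u \<in> verts G\<close>
proof (induction j arbitrary: u)
  case 0
  then have "out_ball G 0 u = {u}" by (auto simp: out_ball_def awalk_Nil_iff)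
  then show ?case by (simp add: moore_bound_def)
next
  case (Suc j)
  obtain A where A: "A \<subseteq> out_arcs G u" "card A = 2"
    using deg[OF Suc.prems(2)] unfolding out_degree_def by (meson obtain_subset_with_card_n)
  obtain e f where "A = {e, f}" and ef: "e \<noteq> f"
    using A(2) by (auto simp: card_2_iff)
  then have arcs: "e \<in> arcs G" "tail G e = u" "f \<in> arcs G" "tail G f = u"
    using A(1) by auto
  let ?E = "out_ball G j (head G e)" and ?F = "out_ball G j (head G f)"
  have step: "\<exists>p. awalk u (g # p) x \<and> length (g # p) \<le> Suc j"
    if "g \<in> arcs G" "tail G g = u" "x \<in> out_ball G j (head G g)" for g x
    using that by (auto simp: out_ball_def awalk_Cons_iff)
  have "u \<notin> out_ball G j (head G g)" if g: "g \<in> arcs G" "tail G g = u" for g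
  proof
    assume "u \<in> out_ball G j (head G g)"
    then obtain p where p: "awalk u (g # p) u" "length (g # p) \<le> Suc j"
      using step g by blast
    have "g # p = []"
      using awalk_unique[OF assms(1) p(1), of "[]"] p(2) Suc.prems by (simp add: awalk_Nil_iff)
    then show False by simp
  qed
  then have u: "u \<notin> ?E \<union> ?F" using arcs by blast
  have "x \<notin> ?F" if x: "x \<in> ?E" for x
  proof
    assume "x \<in> ?F"
    then obtain q where q: "awalk u (f # q) x" "length (f # q) \<le> Suc j"
      using step arcs by blast
    obtain p where p: "awalk u (e # p) x" "length (e # p) \<le> Suc j"
      using step arcs x by blast
    have "e # p = f # q"
      using awalk_unique[OF assms(1) p(1) q(1)] p(2) q(2) Suc.prems by simp
    then show False using ef by simp
  qed
  then have "?E \<inter> ?F = {}" by blast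
  then have "card (insert u (?E \<union> ?F)) = 1 + (card ?E + card ?F)"
    using u by (simp add: card_Un_disjoint finite_out_ball)
  moreover have "insert u (?E \<union> ?F) \<subseteq> out_ball G (Suc j) u"
  proof -
    have "awalk u [] u" using Suc.prems by (simp add: awalk_Nil_iff)
    then have "u \<in> out_ball G (Suc j) u" unfolding out_ball_def by fastforce
    moreover have "?E \<union> ?F \<subseteq> out_ball G (Suc j) u"
      using step arcs unfolding out_ball_def[of G "Suc j"] by blast
    ultimately show ?thesis by blast
  qed
  then have "card (insert u (?E \<union> ?F)) \<le> card (out_ball G (Suc j) u)"
    by (rule card_mono[OF finite_out_ball])
  moreover have "moore_bound 2 j \<le> card ?E" "moore_bound 2 j \<le> card ?F"
    using Suc arcs by simp_all
  ultimately show ?case by (simp add: moore_bound_Suc)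
qed

section \<open>In-neighbours and outliers\<close>

text \<open>A short walk to the tail of \<open>e\<close>, extended by \<open>e\<close>, is
  determined by its first arc, since at most \<open>k\<close> arcs remain after it. As its last arc
  is \<open>e\<close>, the map from \<open>e\<close> to that first arc is injective.\<close>

lemma card_in_arcs_out_ball_le:
  assumes "k_geodetic k G"
  shows "card {e \<in> in_arcs G v. tail G e \<in> out_ball G k u} \<le> out_degree G u"
proof -
  let ?I = "{e \<in> in_arcs G v. tail G e \<in> out_ball G k u}"
  have "\<forall>e\<in>?I. \<exists>p. awalk u p (tail G e) \<and> length p \<le> k"
    by (auto simp: out_ball_def)
  from bchoice[OF this] obtain P
    where P: "awalk u (P e) (tail G e)" "length (P e) \<le> k" if "e \<in> ?I" for e
    by blast
  have W: "awalk u (P e @ [e]) v" if "e \<in> ?I" for e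
    using awalk_snoc[OF P(1)] that by auto
  \<comment> \<open>If \<open>P e\<close> is empty, then \<open>e\<close> itself is the first arc,
    hence \<open>hd\<close> and \<open>tl\<close> of the extended walk.\<close>
  have Q: "hd (P e @ [e]) \<in> out_arcs G u" "length (tl (P e @ [e])) \<le> k"
      "awalk (head G (hd (P e @ [e]))) (tl (P e @ [e])) v" if "e \<in> ?I" for e
    using W[OF that] P(2)[OF that] by (cases "P e"; auto simp: awalk_Cons_iff)+
  have "inj_on (\<lambda>e. hd (P e @ [e])) ?I"
  proof (rule inj_onI)
    fix e f assume e: "e \<in> ?I" and f: "f \<in> ?I" and eq: "hd (P e @ [e]) = hd (P f @ [f])"
    have "tl (P e @ [e]) = tl (P f @ [f])"
      using awalk_unique[OF assms Q(3)[OF e]] Q(2,3)[OF f] Q(2)[OF e] eq by simp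
    then have "P e @ [e] = P f @ [f]"
      using eq by (metis list.expand snoc_eq_iff_butlast)
    then show "e = f" by simp
  qed
  moreover have "(\<lambda>e. hd (P e @ [e])) ` ?I \<subseteq> out_arcs G u" using Q(1) by blast
  ultimately show ?thesis
    unfolding out_degree_def by (rule card_inj_on_le) (rule finite_out_arcs)
qed

text \<open>If every vertex reached \<open>w\<close>, all these walks, unless empty, would end with
  the only arc \<open>f\<close> into \<open>w\<close>. Two out-arcs of a vertex \<open>u\<close>
  other than the tail of \<open>f\<close> would then start distinct walks from \<open>u\<close> to
  that tail.\<close>

lemma in_degree_1_outlier:
  assumes "k_geodetic k G" and deg: "\<And>v. v \<in> verts G \<Longrightarrow> out_degree G v \<ge> 2"
    and "card (verts G) \<ge> 2" "in_degree G w = 1"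
  shows "\<exists>u\<in>verts G. w \<notin> out_ball G k u"
proof (rule ccontr)
  assume "\<not> ?thesis"
  then have reach: "w \<in> out_ball G k u" if "u \<in> verts G" for u using that by blast
  obtain f where f: "in_arcs G w = {f}"
    using assms(4) unfolding in_degree_def by (auto simp: card_1_singleton_iff)
  have "\<not> verts G \<subseteq> {tail G f}"
    using assms(3) card_mono[of "{tail G f}" "verts G"] by auto
  then obtain u where u: "u \<in> verts G" "u \<noteq> tail G f" by blast
  obtain A where A: "A \<subseteq> out_arcs G u" "card A = 2"
    using deg[OF u(1)] unfolding out_degree_def by (meson obtain_subset_with_card_n)
  obtain e g where "A = {e, g}" and eg: "e \<noteq> g"
    using A(2) by (auto simp: card_2_iff)
  then have arcs: "e \<in> out_arcs G u" "g \<in> out_arcs G u" using A(1) by auto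
  \<comment> \<open>Prepending \<open>h\<close> and removing the final \<open>f\<close> keeps the
    length at most \<open>k\<close>. The walk from the head of \<open>h\<close> is nonempty because
    \<open>u\<close> is not the tail of \<open>f\<close>.\<close>
  have walk: "\<exists>q. awalk u (h # q) (tail G f) \<and> length (h # q) \<le> k" if h: "h \<in> out_arcs G u" for h
  proof -
    obtain p where p: "awalk (head G h) p w" "length p \<le> k"
      using reach[of "head G h"] h by (auto simp: out_ball_def)
    have "h \<notin> in_arcs G w" using f u(2) h by auto
    then have "p \<noteq> []" using p(1) h by (auto simp: awalk_Nil_iff)
    then obtain q l where q: "p = q @ [l]" by (metis rev_exhaust)
    have l: "awalk (head G h) q (tail G l)" "l \<in> in_arcs G w"
      using p(1) unfolding q by (auto simp: awalk_append_iff awalk_Cons_iff awalk_Nil_iff)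
    then have "l = f" using f by simp
    then have "awalk u (h # q) (tail G f)" using l(1) h by (auto simp: awalk_Cons_iff)
    then show ?thesis using p(2) q by auto
  qed
  obtain p where p: "awalk u (e # p) (tail G f)" "length (e # p) \<le> k"
    using walk[OF arcs(1)] by blast
  obtain q where q: "awalk u (g # q) (tail G f)" "length (g # q) \<le> k"
    using walk[OF arcs(2)] by blast
  have "e # p = g # q" using awalk_unique[OF assms(1) p(1) q(1) p(2) q(2)] .
  then show False using eg by simp
qed

text \<open>At least 4 - 2 arcs into \<open>v\<close> start outside the ball. Without parallel arcs
  their tails are distinct outliers, and at most two outliers exist, so these are all.\<close>

lemma outliers_subset_in_neighbours:
  assumes geo: "k_geodetic k G" and "k \<ge> 1"
    and "out_degree G u = 2" "in_degree G v = 4" "card (verts G - out_ball G k u) \<le> 2"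
  shows "verts G - out_ball G k u \<subseteq> tail G ` in_arcs G v"
proof -
  interpret digraph G using k_geodetic_imp_digraph[OF _ geo \<open>k \<ge> 1\<close>] fin_digraph_axioms by blast
  let ?O = "verts G - out_ball G k u" and ?N = "{e \<in> in_arcs G v. tail G e \<in> out_ball G k u}"
  have "inj_on (tail G) (in_arcs G v)"
    by (rule inj_onI) (auto intro!: no_multi_arcs simp: arc_to_ends_def)
  then have "inj_on (tail G) (in_arcs G v - ?N)" by (rule inj_on_subset) blast
  then have "card (tail G ` (in_arcs G v - ?N)) = card (in_arcs G v - ?N)" by (rule card_image)
  also have "\<dots> = card (in_arcs G v) - card ?N" by (rule card_Diff_subset) auto
  finally have "card ?O \<le> card (tail G ` (in_arcs G v - ?N))"
    using card_in_arcs_out_ball_le[OF geo, of v u] assms(3,4,5) unfolding in_degree_def by linarith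
  moreover have "tail G ` (in_arcs G v - ?N) \<subseteq> ?O" by auto
  ultimately have "tail G ` (in_arcs G v - ?N) = ?O" by (intro card_seteq) auto
  then show ?thesis by blast
qed

section \<open>Degree counts from the in-degree sequence\<close>

lemma card_in_degree_eq:
  assumes "in_degree_sequence G = xs"
  shows "card {v \<in> verts G. in_degree G v = d} = count_list xs d"
proof -
  have "mset xs = image_mset (in_degree G) (mset_set (verts G))"
    using assms unfolding in_degree_sequence_def by (metis mset_sorted_list_of_multiset)
  then have "count_list xs d = count (image_mset (in_degree G) (mset_set (verts G))) d"
    by (metis count_mset)
  also have "\<dots> = card {v \<in> verts G. in_degree G v = d}"
    by (simp add: count_image_mset' flip: card_eq_sum) (simp add: conj_commute eq_commute)
  finally show ?thesis by simp
qed

lemma card_arcs_in_degree_sequence: "card (arcs G) = sum_list (in_degree_sequence G)"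
proof -
  have "sum_list (in_degree_sequence G) = sum_mset (image_mset (in_degree G) (mset_set (verts G)))"
    unfolding in_degree_sequence_def
    by (metis mset_sorted_list_of_multiset sum_mset_sum_list)
  then show ?thesis by (simp add: sum_in_degree flip: sum_unfold_sum_mset)
qed

lemma out_degree_eq_min:
  assumes deg: "\<And>v. v \<in> verts G \<Longrightarrow> out_degree G v \<ge> d"
    and "card (arcs G) = d * card (verts G)" "u \<in> verts G"
  shows "out_degree G u = d"
proof (rule ccontr)
  assume "out_degree G u \<noteq> d"
  then have "d < out_degree G u" using deg[OF assms(3)] by simp
  then have "(\<Sum>v\<in>verts G. d) < (\<Sum>v\<in>verts G. out_degree G v)"
    using deg assms(3) by (intro sum_strict_mono_ex1) auto
  then show False using assms(2) by (simp add: sum_out_degree mult.commute)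
qed

section \<open>Four vertices with common out-neighbours\<close>

lemma no_in_degrees_1_1_1_1_4_4:
  assumes geo: "k_geodetic k G" and "k \<ge> 1"
    and deg: "\<And>v. v \<in> verts G \<Longrightarrow> out_degree G v = 2"
    and order: "card (verts G) = moore_bound 2 k + 2"
    and four: "card {v \<in> verts G. in_degree G v = 4} = 2"
    and one: "card {v \<in> verts G. in_degree G v = 1} = 4"
  shows False
proof -
  interpret digraph G using k_geodetic_imp_digraph[OF _ geo \<open>k \<ge> 1\<close>] fin_digraph_axioms by blast
  let ?S = "{v \<in> verts G. in_degree G v = 1}" and ?T = "{v \<in> verts G. in_degree G v = 4}"
  have outliers: "card (verts G - out_ball G k u) \<le> 2" if "u \<in> verts G" for u
    using card_out_ball_ge[OF geo _ order_refl that] deg order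
    by (simp add: card_Diff_subset finite_out_ball out_ball_subset)
  have arc: "\<exists>e\<in>out_arcs G w. head G e = v" if w: "w \<in> ?S" and v: "v \<in> ?T" for w v
  proof -
    obtain u where u: "u \<in> verts G" "w \<notin> out_ball G k u"
      using in_degree_1_outlier[OF geo, of w] deg order w by auto
    have "w \<in> tail G ` in_arcs G v"
      using outliers_subset_in_neighbours[OF geo \<open>k \<ge> 1\<close> deg[OF u(1)] _ outliers[OF u(1)]] u v w
      by blast
    then show ?thesis by auto
  qed
  have "?S \<noteq> {}"
    using one by (intro notI) (simp only: card.empty)
  then obtain w where w: "w \<in> ?S" by blast
  \<comment> \<open>The two out-arcs of \<open>w\<close> are used up by the two vertices of
    \<open>?T\<close>.\<close>
  have out: "head G ` out_arcs G w = ?T"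
  proof -
    have "?T \<subseteq> head G ` out_arcs G w" using arc[OF w] by blast
    moreover have "card (head G ` out_arcs G w) \<le> card ?T"
      using card_image_le[OF finite_out_arcs, of "head G" w] deg[of w] w four
      by (simp add: out_degree_def)
    ultimately have "?T = head G ` out_arcs G w" by (intro card_seteq) auto
    then show ?thesis by simp
  qed
  have "x \<notin> out_ball G k w" if x: "x \<in> ?S - {w}" for x
  proof
    assume "x \<in> out_ball G k w"
    then obtain p where p: "awalk w p x" "length p \<le> k" by (auto simp: out_ball_def)
    have "p \<noteq> []" using p x by (auto simp: awalk_Nil_iff)
    then obtain e q where "p = e # q" by (cases p) auto
    then have e: "e \<in> out_arcs G w" and q: "awalk (head G e) q x" "length q < k"
      using p by (auto simp: awalk_Cons_iff)
    have "head G e \<in> ?T" using e out by blast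
    then obtain f where f: "f \<in> out_arcs G x" "head G f = head G e" using arc x by blast
    \<comment> \<open>Dropping \<open>e\<close> left fewer than \<open>k\<close> arcs, so this
      closed walk still has length at most \<open>k\<close> and must equal the empty walk.\<close>
    have "awalk (head G e) (q @ [f]) (head G e)" using awalk_snoc[of "head G e" q f] f q by auto
    then have "q @ [f] = []"
      using awalk_unique[OF geo, of "head G e" "q @ [f]" "head G e" "[]"] q e
      by (auto simp: awalk_Nil_iff)
    then show False by simp
  qed
  then have "?S - {w} \<subseteq> verts G - out_ball G k w" by blast
  then have "card (?S - {w}) \<le> card (verts G - out_ball G k w)" by (intro card_mono) auto
  moreover have "card (?S - {w}) = 3" using one w by (subst card_Diff_singleton) auto
  ultimately show False using outliers[of w] w by simp
qed

end

theorem theorem2: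
  fixes k :: nat
  assumes "k \<ge> 2"
  shows "\<nexists>G :: ('a, 'b) pre_digraph.
           fin_digraph G \<and> k_geodetic k G \<and> min_out_degree G \<ge> 2 \<and>
           card (verts G) = moore_bound 2 k + 2 \<and>
           in_degree_sequence G =
             [1, 1, 1, 1] @ replicate (moore_bound 2 k - 4) 2 @ [4, 4]"
proof
  assume "\<exists>G :: ('a, 'b) pre_digraph.
           fin_digraph G \<and> k_geodetic k G \<and> min_out_degree G \<ge> 2 \<and>
           card (verts G) = moore_bound 2 k + 2 \<and>
           in_degree_sequence G =
             [1, 1, 1, 1] @ replicate (moore_bound 2 k - 4) 2 @ [4, 4]"
  then obtain G :: "('a, 'b) pre_digraph" where "fin_digraph G" and geo: "k_geodetic k G"
    and min: "min_out_degree G \<ge> 2" and order: "card (verts G) = moore_bound 2 k + 2"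
    and seq: "in_degree_sequence G = [1, 1, 1, 1] @ replicate (moore_bound 2 k - 4) 2 @ [4, 4]"
    by blast
  interpret fin_digraph G by fact
  have "out_degree G v \<ge> 2" if "v \<in> verts G" for v
    using min that unfolding min_out_degree_def
    by (meson Min_le finite_imageI finite_verts image_eqI order_trans)
  \<comment> \<open>With M the Moore bound, 4 + 2(M - 4) + 8 = 2(M + 2).\<close>
  moreover have "card (arcs G) = 2 * card (verts G)"
    using moore_bound_ge_4[OF assms]
    unfolding card_arcs_in_degree_sequence seq order by (simp add: sum_list_replicate)
  ultimately have "out_degree G v = 2" if "v \<in> verts G" for v
    using that by (rule out_degree_eq_min)
  moreover have "count_list (replicate n 2) d = 0" if "d \<noteq> 2" for n d :: nat
    using that by (induction n) auto
  then have "card {v \<in> verts G. in_degree G v = 4} = 2" "card {v \<in> verts G. in_degree G v = 1} = 4"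
    unfolding card_in_degree_eq[OF seq] by simp_all
  ultimately show False
    using no_in_degrees_1_1_1_1_4_4[OF geo _ _ order] assms by simp
qed

end
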